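(* Let $b\in\mathbb C$ and let $g\in\mathbb C[t]$ be a polynomial with zero constant term. The $\mathfrak{sl}(2)$-module $T_2(g,b)$ is simple if and only if $b\notin1+\tfrac12\mathbb Z_{\geq0}$.
   Context: The Lie algebra $\mathfrak{sl}(2)$ over $\mathbb C$ has basis $e,f,h$ with $[h,e]=e$, $[h,f]=-f$, $[e,f]=2h$. $T_2(g,b)$ denotes the space $\mathbb C[t]e^g$ (with $\partial=d/dt$ acting by $\partial(pe^g)=(p'+pg')e^g$) regarded as an $\mathfrak{sl}(2)$-module via $e\mapsto-t\partial^2+(2b-2)\partial$, $f\mapsto t$, $h\mapsto-t\partial+(b-1)$. *)

theory Defs
  imports
    "HOL-Analysis.Analysis"
    "HOL-Computational_Algebra.Polynomial"
    "HOL-Library.Function_Algebras"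
begin

section \<open>Lie algebras and their modules\<close>

text \<open>Both the Lie algebra and the module are carried by subspaces of ambient vector spaces.\<close>

locale lie_algebra = L: vector_space scaleL
  for scaleL :: "'k::field \<Rightarrow> 'a::ab_group_add \<Rightarrow> 'a" +
  fixes L :: "'a set"
    and bracket :: "'a \<Rightarrow> 'a \<Rightarrow> 'a"
  assumes subspace_L: "L.subspace L"
    and bracket_closed: "\<lbrakk>x \<in> L; y \<in> L\<rbrakk> \<Longrightarrow> bracket x y \<in> L"
    and bracket_add_left:
      "\<lbrakk>x \<in> L; y \<in> L; z \<in> L\<rbrakk> \<Longrightarrow> bracket (x + y) z = bracket x z + bracket y z"
    and bracket_add_right:
      "\<lbrakk>x \<in> L; y \<in> L; z \<in> L\<rbrakk> \<Longrightarrow> bracket x (y + z) = bracket x y + bracket x z"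
    and bracket_scale_left:
      "\<lbrakk>x \<in> L; y \<in> L\<rbrakk> \<Longrightarrow> bracket (scaleL c x) y = scaleL c (bracket x y)"
    and bracket_scale_right:
      "\<lbrakk>x \<in> L; y \<in> L\<rbrakk> \<Longrightarrow> bracket x (scaleL c y) = scaleL c (bracket x y)"
    and bracket_self: "x \<in> L \<Longrightarrow> bracket x x = 0"
    and jacobi: "\<lbrakk>x \<in> L; y \<in> L; z \<in> L\<rbrakk> \<Longrightarrow>
      bracket x (bracket y z) + bracket y (bracket z x) + bracket z (bracket x y) = 0"

locale lie_module = lie_algebra scaleL L bracket + V: vector_space scaleV
  for scaleL :: "'k::field \<Rightarrow> 'a::ab_group_add \<Rightarrow> 'a"
    and L :: "'a set"
    and bracket :: "'a \<Rightarrow> 'a \<Rightarrow> 'a"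
    and scaleV :: "'k \<Rightarrow> 'v::ab_group_add \<Rightarrow> 'v" +
  fixes V :: "'v set"
    and act :: "'a \<Rightarrow> 'v \<Rightarrow> 'v"
  assumes subspace_V: "V.subspace V"
    and act_closed: "\<lbrakk>x \<in> L; v \<in> V\<rbrakk> \<Longrightarrow> act x v \<in> V"
    and act_add_left: "\<lbrakk>x \<in> L; y \<in> L; v \<in> V\<rbrakk> \<Longrightarrow> act (x + y) v = act x v + act y v"
    and act_scale_left: "\<lbrakk>x \<in> L; v \<in> V\<rbrakk> \<Longrightarrow> act (scaleL c x) v = scaleV c (act x v)"
    and act_add_right: "\<lbrakk>x \<in> L; v \<in> V; w \<in> V\<rbrakk> \<Longrightarrow> act x (v + w) = act x v + act x w"
    and act_scale_right: "\<lbrakk>x \<in> L; v \<in> V\<rbrakk> \<Longrightarrow> act x (scaleV c v) = scaleV c (act x v)"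
    and act_bracket:
      "\<lbrakk>x \<in> L; y \<in> L; v \<in> V\<rbrakk> \<Longrightarrow> act (bracket x y) v = act x (act y v) - act y (act x v)"
begin

definition submodule :: "'v set \<Rightarrow> bool" where
  "submodule W \<longleftrightarrow> V.subspace W \<and> W \<subseteq> V \<and> (\<forall>x\<in>L. \<forall>w\<in>W. act x w \<in> W)"

end

locale simple_lie_module = lie_module +
  assumes nonzero: "V \<noteq> {0}"
    and submodule_trivial: "submodule W \<Longrightarrow> W = {0} \<or> W = V"

section \<open>The Lie algebra \<open>sl(2)\<close> over the complex numbers\<close>

text \<open>On matrices the library's \<open>*s\<close> only scales rows, and \<open>*\<^sub>R\<close> only takes real scalars.\<close>

definition mat_scale :: "complex \<Rightarrow> complex^2^2 \<Rightarrow> complex^2^2" where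
  "mat_scale c A = (\<chi> i j. c * A $ i $ j)"

definition sl2 :: "(complex^2^2) set" where
  "sl2 = {A. trace A = 0}"

definition sl2_bracket :: "complex^2^2 \<Rightarrow> complex^2^2 \<Rightarrow> complex^2^2" where
  "sl2_bracket A B = A ** B - B ** A"

text \<open>
  The relations \<open>[h,e] = e\<close>, \<open>[h,f] = -f\<close>, \<open>[e,f] = 2h\<close> force \<open>h\<close> to be half of
  the usual \<open>diag(1,-1)\<close>.
\<close>

definition sl2_e :: "complex^2^2" where
  "sl2_e = vector [vector [0, 1], vector [0, 0]]"

definition sl2_f :: "complex^2^2" where
  "sl2_f = vector [vector [0, 0], vector [1, 0]]"

definition sl2_h :: "complex^2^2" where
  "sl2_h = vector [vector [1/2, 0], vector [0, -1/2]]"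

lemmas sl2_basis_defs = sl2_e_def sl2_f_def sl2_h_def

lemma sl2_iff: "A \<in> sl2 \<longleftrightarrow> A$2$2 = - A$1$1"
  by (simp add: sl2_def trace_def sum_2 add_eq_0_iff)

lemma sl2_basis_mem: "sl2_e \<in> sl2" "sl2_f \<in> sl2" "sl2_h \<in> sl2"
  by (simp_all add: sl2_iff sl2_basis_defs)

lemma sl2_relations:
  "sl2_bracket sl2_h sl2_e = sl2_e"
  "sl2_bracket sl2_h sl2_f = - sl2_f"
  "sl2_bracket sl2_e sl2_f = mat_scale 2 sl2_h"
  by (simp_all add: sl2_bracket_def mat_scale_def sl2_basis_defs vec_eq_iff forall_2
      matrix_matrix_mult_def sum_2)

lemma sl2_basis_unique:
  assumes "A \<in> sl2"
  shows "A = mat_scale x sl2_e + mat_scale y sl2_f + mat_scale z sl2_h \<longleftrightarrow>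
    x = A$1$2 \<and> y = A$2$1 \<and> z = 2 * A$1$1"
  using assms by (auto simp: sl2_iff mat_scale_def sl2_basis_defs vec_eq_iff forall_2)

lemma vector_space_mat_scale: "vector_space mat_scale"
  by unfold_locales (simp_all add: mat_scale_def vec_eq_iff algebra_simps)

lemma lie_algebra_sl2: "lie_algebra mat_scale sl2 sl2_bracket"
proof -
  interpret vector_space mat_scale by (rule vector_space_mat_scale)
  show ?thesis
    by unfold_locales
      (auto simp: subspace_def sl2_iff sl2_bracket_def mat_scale_def vec_eq_iff forall_2
        matrix_matrix_mult_def sum_2 algebra_simps)
qed

section \<open>The module \<open>T\<^sub>2(g,b)\<close>\<close>

definition fun_scale :: "complex \<Rightarrow> (complex \<Rightarrow> complex) \<Rightarrow> complex \<Rightarrow> complex" where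
  "fun_scale c F = (\<lambda>t. c * F t)"

definition poly_exp :: "complex poly \<Rightarrow> complex poly \<Rightarrow> complex \<Rightarrow> complex" where
  "poly_exp g p = (\<lambda>t. poly p t * exp (poly g t))"

definition T2_space :: "complex poly \<Rightarrow> (complex \<Rightarrow> complex) set" where
  "T2_space g = range (poly_exp g)"

definition T2_e :: "complex \<Rightarrow> (complex \<Rightarrow> complex) \<Rightarrow> complex \<Rightarrow> complex" where
  "T2_e b F = (\<lambda>t. - t * deriv (deriv F) t + (2 * b - 2) * deriv F t)"

definition T2_f :: "(complex \<Rightarrow> complex) \<Rightarrow> complex \<Rightarrow> complex" where
  "T2_f F = (\<lambda>t. t * F t)"

definition T2_h :: "complex \<Rightarrow> (complex \<Rightarrow> complex) \<Rightarrow> complex \<Rightarrow> complex" where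
  "T2_h b F = (\<lambda>t. - t * deriv F t + (b - 1) * F t)"

text \<open>
  The linear extension of \<open>e \<mapsto> T2_e b\<close>, \<open>f \<mapsto> T2_f\<close>, \<open>h \<mapsto> T2_h b\<close>: a trace-zero
  matrix \<open>A\<close> has coordinates \<open>A$1$2\<close>, \<open>A$2$1\<close>, \<open>2 * A$1$1\<close> in the basis \<open>e, f, h\<close>.
\<close>

definition T2_act :: "complex \<Rightarrow> complex^2^2 \<Rightarrow> (complex \<Rightarrow> complex) \<Rightarrow> complex \<Rightarrow> complex" where
  "T2_act b A F = fun_scale (A$1$2) (T2_e b F) + fun_scale (A$2$1) (T2_f F)
    + fun_scale (2 * A$1$1) (T2_h b F)"

lemma T2_act_basis:
  "T2_act b sl2_e = T2_e b" "T2_act b sl2_f = T2_f" "T2_act b sl2_h = T2_h b"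
  by (simp_all add: T2_act_def sl2_basis_defs fun_scale_def fun_eq_iff)

lemma deriv_poly_exp: "deriv (poly_exp g p) = poly_exp g (pderiv p + p * pderiv g)"
proof
  fix t
  have "(poly_exp g p has_field_derivative poly_exp g (pderiv p + p * pderiv g) t) (at t)"
    unfolding poly_exp_def by (auto intro!: derivative_eq_intros simp: algebra_simps)
  then show "deriv (poly_exp g p) t = poly_exp g (pderiv p + p * pderiv g) t"
    by (rule DERIV_imp_deriv)
qed

lemma vector_space_fun_scale: "vector_space fun_scale"
  by unfold_locales (simp_all add: fun_scale_def fun_eq_iff algebra_simps)

lemma lie_module_T2:
  "lie_module mat_scale sl2 sl2_bracket fun_scale (T2_space g) (T2_act b)"
proof -
  interpret lie_algebra mat_scale sl2 sl2_bracket by (rule lie_algebra_sl2)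
  interpret V: vector_space fun_scale by (rule vector_space_fun_scale)
  define D where "D p = pderiv p + p * pderiv g" for p
  define P where "P A p = smult (A$1$2) (- pCons 0 (D (D p)) + smult (2 * b - 2) (D p))
      + smult (A$2$1) (pCons 0 p)
      + smult (2 * A$1$1) (- pCons 0 (D p) + smult (b - 1) p)" for A :: "complex^2^2" and p
  have D_simps: "D (p + q) = D p + D q" "D (p - q) = D p - D q" "D (- p) = - D p"
    "D (smult c p) = smult c (D p)" "D (pCons 0 p) = p + pCons 0 (D p)" for p q c
    by (simp_all add: D_def pderiv_add pderiv_diff pderiv_minus pderiv_smult pderiv_pCons
        algebra_simps smult_add_right)
  have act: "T2_act b A (poly_exp g p) = poly_exp g (P A p)" for A p
    by (simp add: T2_act_def T2_e_def T2_f_def T2_h_def deriv_poly_exp flip: D_def)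
      (simp add: P_def poly_exp_def fun_scale_def fun_eq_iff algebra_simps)
  have ev: "poly_exp g p + poly_exp g q = poly_exp g (p + q)"
    "poly_exp g p - poly_exp g q = poly_exp g (p - q)"
    "fun_scale c (poly_exp g p) = poly_exp g (smult c p)" "0 = poly_exp g 0" for p q c
    by (simp_all add: poly_exp_def fun_scale_def fun_eq_iff algebra_simps)
  have br: "P (sl2_bracket A B) p = P A (P B p) - P B (P A p)"
    if "A \<in> sl2" "B \<in> sl2" for A B p
    using that
    by (simp add: P_def D_simps sl2_iff sl2_bracket_def matrix_matrix_mult_def sum_2
        poly_eq_poly_eq_iff [symmetric] fun_eq_iff algebra_simps)
  have lin: "P (A + B) p = P A p + P B p" "P (mat_scale c A) p = smult c (P A p)"
    "P A (p + q) = P A p + P A q" "P A (smult c p) = smult c (P A p)" for A B p q c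
    by (simp_all add: P_def D_simps mat_scale_def
        poly_eq_poly_eq_iff [symmetric] fun_eq_iff algebra_simps)
  show ?thesis
  proof unfold_locales
    show "V.subspace (T2_space g)"
      unfolding V.subspace_def T2_space_def by (auto simp: ev)
  qed (auto simp: T2_space_def act ev br lin)
qed

end

theory Submission
  imports Defs
begin

text \<open>
  In terms of the polynomial factor \<open>p\<close> of \<open>p e\<^sup>g\<close>, the operator \<open>h\<close> acts as \<open>- t p'\<close> and \<open>e\<close> as
  \<open>- t p'' + (2 b - 2) p'\<close>, up to multiples of \<open>p\<close> and of \<open>t p'\<close>. Hence the submodules of \<open>T\<^sub>2(g,b)\<close>
  correspond to the ideals of \<open>\<complex>[t]\<close> that are closed under these two operators, whatever \<open>g\<close> is.
  Closure under the first one makes an element of least degree \<open>d\<close> of a nonzero such ideal a multiple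
  of \<open>t\<^sup>d\<close>, and the second one sends \<open>t\<^sup>d\<close> to \<open>d (2 b - 1 - d) t\<^sup>d\<^sup>-\<^sup>1\<close>, which must then vanish.
  So a proper nonzero submodule exists precisely when \<open>2 b - 1\<close> is a positive integer \<open>d\<close>,
  and then the ideal generated by \<open>t\<^sup>d\<close> gives one.
\<close>

interpretation T2: lie_module mat_scale sl2 sl2_bracket fun_scale "T2_space g" "T2_act b" for g b
  by (rule lie_module_T2)

definition euler_op :: "'a::idom poly \<Rightarrow> 'a poly" where
  "euler_op p = pCons 0 (pderiv p)"

text \<open>This is the action of \<open>sl2_e\<close> in the case \<open>g = 0\<close>. It raises
  weights, as \<open>[h,e] = e\<close>, but lowers degrees by one.\<close>

definition raising_op :: "complex \<Rightarrow> complex poly \<Rightarrow> complex poly" where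
  "raising_op b p = smult (2 * b - 2) (pderiv p) - pCons 0 (pderiv (pderiv p))"

definition T2_ideal :: "complex \<Rightarrow> complex poly set \<Rightarrow> bool" where
  "T2_ideal b J \<longleftrightarrow> 0 \<in> J \<and> (\<forall>p\<in>J. \<forall>q\<in>J. p + q \<in> J) \<and> (\<forall>p\<in>J. \<forall>r. r * p \<in> J)
    \<and> (\<forall>p\<in>J. euler_op p \<in> J) \<and> (\<forall>p\<in>J. raising_op b p \<in> J)"

lemma T2_idealD:
  assumes "T2_ideal b J"
  shows "0 \<in> J" "p \<in> J \<Longrightarrow> q \<in> J \<Longrightarrow> p + q \<in> J" "p \<in> J \<Longrightarrow> r * p \<in> J"
    "p \<in> J \<Longrightarrow> smult c p \<in> J" "p \<in> J \<Longrightarrow> q \<in> J \<Longrightarrow> p - q \<in> J"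
    "p \<in> J \<Longrightarrow> euler_op p \<in> J" "p \<in> J \<Longrightarrow> raising_op b p \<in> J"
proof -
  note J = assms[unfolded T2_ideal_def]
  show *: "p \<in> J \<Longrightarrow> smult c p \<in> J" for c p
    using J by (metis mult.left_neutral mult_smult_left)
  show "p \<in> J \<Longrightarrow> q \<in> J \<Longrightarrow> p - q \<in> J"
    using J *[of q "-1"] by (metis diff_conv_add_uminus smult_1_left smult_minus_left)
qed (use assms in \<open>auto simp: T2_ideal_def\<close>)

lemma coeff_euler_op: "coeff (euler_op p) i = of_nat i * coeff p i"
  by (cases i) (simp_all add: euler_op_def coeff_pderiv)

text \<open>Each monomial goes to a multiple of the one below it. The factor
  \<open>2 * b - 2 - of_nat i\<close> is where \<open>b\<close> decides whether a nonconstant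
  monomial is killed.\<close>

lemma coeff_raising_op:
  "coeff (raising_op b p) i = (2 * b - 2 - of_nat i) * of_nat (Suc i) * coeff p (Suc i)"
  by (cases i) (simp_all add: raising_op_def coeff_pderiv algebra_simps)

lemma inj_poly_exp: "inj (poly_exp g)"
  by (rule injI) (simp add: poly_exp_def fun_eq_iff flip: poly_eq_poly_eq_iff)

lemma poly_exp_simps:
  "poly_exp g p + poly_exp g q = poly_exp g (p + q)"
  "poly_exp g p - poly_exp g q = poly_exp g (p - q)"
  "fun_scale c (poly_exp g p) = poly_exp g (smult c p)"
  "poly_exp g 0 = 0"
  by (simp_all add: poly_exp_def fun_scale_def fun_eq_iff algebra_simps)

lemma T2_f_poly_exp: "T2_f (poly_exp g p) = poly_exp g (pCons 0 p)"
  by (simp add: T2_f_def poly_exp_def fun_eq_iff)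

lemma T2_h_poly_exp:
  "T2_h b (poly_exp g p) = poly_exp g (([:b - 1:] - pCons 0 (pderiv g)) * p - euler_op p)"
  by (simp add: T2_h_def deriv_poly_exp euler_op_def)
    (simp add: poly_exp_def fun_eq_iff algebra_simps)

text \<open>The cross term \<open>- 2 t p' g'\<close> of the second derivative is a polynomial
  multiple of \<open>euler_op p\<close>. Grouped this way, all terms but
  \<open>raising_op b p\<close> are polynomial multiples of \<open>p\<close> or of
  \<open>euler_op p\<close>.\<close>

lemma T2_e_poly_exp:
  "T2_e b (poly_exp g p) = poly_exp g (raising_op b p - (smult 2 (pderiv g)) * euler_op p
    + (smult (2 * b - 2) (pderiv g) - pCons 0 (pderiv (pderiv g) + pderiv g * pderiv g)) * p)"
  by (simp add: T2_e_def deriv_poly_exp euler_op_def raising_op_def)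
    (simp add: poly_exp_def pderiv_add pderiv_mult fun_eq_iff algebra_simps)

lemma T2_ideal_imp_submodule:
  assumes J: "T2_ideal b J"
  shows "T2.submodule g b (poly_exp g ` J)"
proof -
  note D = T2_idealD[OF J]
  have shift: "pCons 0 p \<in> J" if "p \<in> J" for p
    using D(3)[OF that, of "[:0, 1:]"] by simp
  have ops: "T2_e b (poly_exp g p) \<in> poly_exp g ` J" "T2_f (poly_exp g p) \<in> poly_exp g ` J"
    "T2_h b (poly_exp g p) \<in> poly_exp g ` J" if "p \<in> J" for p
  proof -
    show "T2_e b (poly_exp g p) \<in> poly_exp g ` J"
      unfolding T2_e_poly_exp by (rule imageI D(2) D(5) D(3) D(6) D(7) that)+
    show "T2_f (poly_exp g p) \<in> poly_exp g ` J"
      unfolding T2_f_poly_exp by (rule imageI shift that)+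
    show "T2_h b (poly_exp g p) \<in> poly_exp g ` J"
      unfolding T2_h_poly_exp by (rule imageI D(5) D(3) D(6) that)+
  qed
  have "poly_exp g 0 \<in> poly_exp g ` J"
    by (rule imageI D(1))+
  then have sub: "T2.V.subspace (poly_exp g ` J)"
    unfolding T2.V.subspace_def
    by (auto simp only: poly_exp_simps intro!: imageI D(2,4))
  have "T2_act b A (poly_exp g p) \<in> poly_exp g ` J" if "p \<in> J" for A p
    unfolding T2_act_def
    by (intro T2.V.subspace_add[OF sub] T2.V.subspace_scale[OF sub] ops that)
  with sub show ?thesis
    unfolding T2.submodule_def by (auto simp: T2_space_def)
qed

text \<open>The order matters: \<open>f\<close> gives multiplication by t and so, by induction on
  the multiplier, an ideal. Modulo multiples of \<open>p\<close>, \<open>h\<close> then gives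
  \<open>euler_op\<close>. Modulo multiples of \<open>p\<close> and \<open>euler_op p\<close>,
  \<open>e\<close> gives \<open>raising_op\<close>.\<close>

lemma submodule_imp_T2_ideal:
  assumes W: "T2.submodule g b W"
  shows "T2_ideal b (poly_exp g -` W)"
proof -
  let ?J = "poly_exp g -` W"
  have sub: "T2.V.subspace W" and act: "\<And>x w. x \<in> sl2 \<Longrightarrow> w \<in> W \<Longrightarrow> T2_act b x w \<in> W"
    using W by (auto simp: T2.submodule_def)
  have zero: "0 \<in> ?J"
    using T2.V.subspace_0[OF sub] by (simp add: poly_exp_simps)
  have add: "p + q \<in> ?J" if "p \<in> ?J" "q \<in> ?J" for p q
    using T2.V.subspace_add[OF sub, of "poly_exp g p" "poly_exp g q"] that
    by (simp add: poly_exp_simps)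
  have diff: "p - q \<in> ?J" if "p \<in> ?J" "q \<in> ?J" for p q
    using T2.V.subspace_diff[OF sub, of "poly_exp g p" "poly_exp g q"] that
    by (simp add: poly_exp_simps)
  have scale: "smult c p \<in> ?J" if "p \<in> ?J" for p c
    using T2.V.subspace_scale[OF sub, of "poly_exp g p" c] that by (simp add: poly_exp_simps)
  have shift: "pCons 0 p \<in> ?J" if "p \<in> ?J" for p
    using act[OF sl2_basis_mem(2)] that by (simp add: T2_act_basis flip: T2_f_poly_exp)
  have mult: "r * p \<in> ?J" if "p \<in> ?J" for p r
    by (induction r) (use that zero in \<open>auto simp del: vimage_eq intro: add scale shift\<close>)
  have euler: "euler_op p \<in> ?J" if "p \<in> ?J" for p
  proof -
    have "([:b - 1:] - pCons 0 (pderiv g)) * p - euler_op p \<in> ?J" (is "?r * p - _ \<in> _")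
      using act[OF sl2_basis_mem(3)] that
      unfolding vimage_eq T2_act_basis by (metis T2_h_poly_exp)
    from diff[OF mult[OF that, of ?r] this] show ?thesis
      by (simp only: diff_diff_eq2 add_diff_cancel_left')
  qed
  have raising: "raising_op b p \<in> ?J" if "p \<in> ?J" for p
  proof -
    let ?r = "smult 2 (pderiv g)"
    let ?s = "smult (2 * b - 2) (pderiv g) - pCons 0 (pderiv (pderiv g) + pderiv g * pderiv g)"
    have "raising_op b p - ?r * euler_op p + ?s * p \<in> ?J"
      using act[OF sl2_basis_mem(1)] that
      unfolding vimage_eq T2_act_basis by (metis T2_e_poly_exp)
    from add[OF diff[OF this mult[OF that, of ?s]] mult[OF euler[OF that], of ?r]] show ?thesis
      by (simp only: add_diff_cancel_right' diff_add_cancel)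
  qed
  show ?thesis
    unfolding T2_ideal_def using zero add mult euler raising by blast
qed

lemma T2_ideal_trivial:
  assumes J: "T2_ideal b J" and nz: "J \<noteq> {0}" and b: "\<And>n::nat. b \<noteq> 1 + of_nat n / 2"
  shows "J = UNIV"
proof -
  note D = T2_idealD[OF J]
  obtain q where q: "q \<in> J" "q \<noteq> 0"
    and least: "\<And>p. p \<in> J \<Longrightarrow> p \<noteq> 0 \<Longrightarrow> degree q \<le> degree p"
  proof -
    have "\<exists>q. q \<in> J \<and> q \<noteq> 0"
      using nz D(1) by blast
    from ex_has_least_nat[of "\<lambda>p. p \<in> J \<and> p \<noteq> 0" _ degree, OF someI_ex[OF this]] that
    show thesis by blast
  qed
  define d where "d = degree q"
  have vanish: "p = 0" if "p \<in> J" "\<And>i. i \<ge> d \<Longrightarrow> coeff p i = 0" for p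
    using least[of p] that leading_coeff_neq_0[of p] by (auto simp: d_def)
  \<comment> \<open>Subtracting \<open>d\<close> times \<open>q\<close> cancels the leading term, so
    the difference lies in \<open>J\<close> with degree below \<open>d\<close>.\<close>
  have "euler_op q - smult (of_nat d) q = 0"
  proof (rule vanish)
    show "coeff (euler_op q - smult (of_nat d) q) i = 0" if "i \<ge> d" for i
      using that by (cases "i = d") (auto simp: coeff_euler_op d_def coeff_eq_0)
  qed (intro D q)
  then have "of_nat i * coeff q i = of_nat d * coeff q i" for i
    by (metis coeff_euler_op coeff_smult eq_iff_diff_eq_0)
  then have off: "coeff q i = 0" if "i \<noteq> d" for i
    using that by auto
  \<comment> \<open>The coefficient at i involves only that of \<open>q\<close> at i + 1, which is
    zero for i \<ge> d.\<close>
  have "raising_op b q = 0"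
    by (rule vanish) (auto simp: coeff_raising_op off intro: D q)
  have "d = 0"
  proof (rule ccontr)
    assume "d \<noteq> 0"
    then obtain n where n: "d = Suc n"
      by (cases d) auto
    have "coeff (raising_op b q) n = 0"
      by (simp add: \<open>raising_op b q = 0\<close>)
    moreover have "coeff q (Suc n) \<noteq> 0"
      using q(2) by (simp add: d_def flip: n)
    \<comment> \<open>Of the three factors, \<open>of_nat (Suc n)\<close> and the leading
      coefficient of \<open>q\<close> are nonzero.\<close>
    ultimately have "2 * b - 2 - of_nat n = 0"
      by (simp add: coeff_raising_op del: of_nat_Suc)
    then have "b = 1 + of_nat n / 2"
      by (simp add: field_simps)
    with b show False by blast
  qed
  then obtain c where c: "q = [:c:]"
    unfolding d_def by (rule degree_eq_zeroE)
  have "p \<in> J" for p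
    using D(3)[OF q(1), of "smult (1 / c) p"] q(2) by (simp add: c)
  then show ?thesis by blast
qed

text \<open>This is the ideal generated by \<open>t^(n+1)\<close>, where n + 1 = 2b - 1.\<close>

lemma T2_ideal_order:
  assumes b: "b = 1 + of_nat n / 2"
  shows "T2_ideal b {p. \<forall>i\<le>n. coeff p i = 0}"
  unfolding T2_ideal_def
proof (intro conjI ballI allI)
  fix p :: "complex poly"
  assume "p \<in> {p. \<forall>i\<le>n. coeff p i = 0}"
  then have p: "coeff p i = 0" if "i \<le> n" for i
    using that by auto
  \<comment> \<open>Only at i = n does a possibly nonzero coefficient of \<open>p\<close> enter, and
    there the factor \<open>2 * b - 2 - of_nat n\<close> is zero.\<close>
  have "coeff (raising_op b p) i = 0" if "i \<le> n" for i
    using that p[of "Suc i"] by (cases "i = n") (auto simp: coeff_raising_op b)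
  then show "raising_op b p \<in> {p. \<forall>i\<le>n. coeff p i = 0}"
    by simp
  show "r * p \<in> {p. \<forall>i\<le>n. coeff p i = 0}" for r
    by (auto simp: coeff_mult p intro!: sum.neutral)
qed (auto simp: coeff_euler_op)

theorem theorem6p12:
  fixes b :: complex and g :: "complex poly"
  assumes "coeff g 0 = 0"
  shows "simple_lie_module mat_scale sl2 sl2_bracket fun_scale (T2_space g) (T2_act b)
    \<longleftrightarrow> b \<notin> {1 + of_nat n / 2 | n :: nat. True}"
proof
  assume simple: "simple_lie_module mat_scale sl2 sl2_bracket fun_scale (T2_space g) (T2_act b)"
  show "b \<notin> {1 + of_nat n / 2 | n :: nat. True}"
  proof
    assume "b \<in> {1 + of_nat n / 2 | n :: nat. True}"
    then obtain n :: nat where "b = 1 + of_nat n / 2"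
      by blast
    define J where "J = {p :: complex poly. \<forall>i\<le>n. coeff p i = 0}"
    have "T2_ideal b J"
      unfolding J_def by (rule T2_ideal_order) fact
    then have "poly_exp g ` J = {0} \<or> poly_exp g ` J = T2_space g"
      by (intro simple_lie_module.submodule_trivial[OF simple] T2_ideal_imp_submodule)
    \<comment> \<open>Both alternatives are written as images so that injectivity carries them back
      to polynomials.\<close>
    then have "poly_exp g ` J = poly_exp g ` {0} \<or> poly_exp g ` J = poly_exp g ` UNIV"
      by (simp add: T2_space_def poly_exp_simps)
    then have "J = {0} \<or> J = UNIV"
      by (simp only: inj_image_eq_iff[OF inj_poly_exp])
    moreover have "monom 1 (Suc n) \<in> J" "1 \<notin> J"
      by (auto simp: J_def)
    ultimately show False
      by (auto simp: monom_eq_0_iff)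
  qed
next
  assume b: "b \<notin> {1 + of_nat n / 2 | n :: nat. True}"
  show "simple_lie_module mat_scale sl2 sl2_bracket fun_scale (T2_space g) (T2_act b)"
  proof
    have "poly_exp g ` UNIV \<noteq> poly_exp g ` {0}"
      unfolding inj_image_eq_iff[OF inj_poly_exp] by (metis UNIV_I singletonD zero_neq_one)
    then show "T2_space g \<noteq> {0}"
      by (simp add: T2_space_def poly_exp_simps)
  next
    fix W assume W: "T2.submodule g b W"
    then have "W \<subseteq> range (poly_exp g)"
      by (simp add: T2.submodule_def flip: T2_space_def)
    \<comment> \<open>As \<open>W\<close> lies in the range, its preimage determines it.\<close>
    then have "W = poly_exp g ` (poly_exp g -` W)"
      by auto
    moreover have "poly_exp g -` W = {0} \<or> poly_exp g -` W = UNIV"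
      using T2_ideal_trivial[OF submodule_imp_T2_ideal[OF W]] b by blast
    ultimately show "W = {0} \<or> W = T2_space g"
      by (metis T2_space_def image_empty image_insert poly_exp_simps(4))
  qed
qed

end
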